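(* Let $V$ be a finite ground set, let $l\ge1$, and let $f_1,\dots,f_l:2^V\to\mathbb{R}_{\ge 0}$ be non-negative set functions. Define $f_{avg}(X)=\frac1l\sum_{i=1}^l f_i(X)$. Then for every $X\subseteq V$, $$f_{avg}(X)\ \le\ \max_{i=1,\dots,l} f_i(X)\ \le\ l\, f_{avg}(X).$$ Moreover, let $\mathcal C\subseteq 2^V$ be a nonempty family of feasible sets, let $\beta\ge1$, and let $\hat X\in\mathcal C$ be a $\beta$-approximate minimizer of $f_{avg}$ over $\mathcal C$, i.e. $f_{avg}(\hat X)\le\beta\min_{X\in\mathcal C} f_{avg}(X)$. Then $$\max_{i=1,\dots,l} f_i(\hat X)\ \le\ l\beta\,\max_{i=1,\dots,l} f_i(X^* ),$$ where $X^*\in\mathcal C$ is an exact minimizer of $\max_{i=1,\dots,l} f_i(X)$ over $X\in\mathcal C$. *)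

theory Defs
  imports Complex_Main
begin

definition f_avg :: "nat \<Rightarrow> (nat \<Rightarrow> 'a set \<Rightarrow> real) \<Rightarrow> 'a set \<Rightarrow> real" where
  "f_avg l f X = (1 / real l) * (\<Sum>i = 1..l. f i X)"

definition f_max :: "nat \<Rightarrow> (nat \<Rightarrow> 'a set \<Rightarrow> real) \<Rightarrow> 'a set \<Rightarrow> real" where
  "f_max l f X = (MAX i\<in>{1..l}. f i X)"

(* Min is the true minimum only for a finite nonempty family C. *)
definition approx_minimizer ::
  "real \<Rightarrow> ('a set \<Rightarrow> real) \<Rightarrow> 'a set set \<Rightarrow> 'a set \<Rightarrow> bool" where
  "approx_minimizer \<beta> g C X \<longleftrightarrow> X \<in> C \<and> g X \<le> \<beta> * (MIN Y\<in>C. g Y)"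

end

theory Submission
  imports Defs
begin

text \<open>The mean of \<open>l\<close> numbers never exceeds their maximum
  (\<open>f_avg_le_f_max\<close>), and for non-negative numbers the maximum never exceeds their sum,
  which is \<open>l\<close> times the mean (\<open>f_max_le_mult_f_avg\<close>). So the average
  approximates the maximum within a factor \<open>l\<close>. The approximation guarantee sandwiches
  the averages between maxima: pass from the maximum at \<open>Xhat\<close> to its average at cost
  \<open>l\<close>, apply approximate optimality at cost \<beta>, compare the minimal average with
  the average at \<open>Xstar\<close>, and return to the maximum there for free.\<close>

lemma real_mult_f_avg: "l \<ge> 1 \<Longrightarrow> real l * f_avg l f X = (\<Sum>i = 1..l. f i X)"
  by (simp add: f_avg_def)

lemma f_avg_le_f_max:
  assumes "l \<ge> 1"
  shows "f_avg l f X \<le> f_max l f X"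
proof -
  have "(\<Sum>i = 1..l. f i X) \<le> of_nat (card {1..l}) * f_max l f X"
    unfolding f_max_def by (rule sum_bounded_above) simp
  then have "real l * f_avg l f X \<le> real l * f_max l f X"
    using assms by (simp add: real_mult_f_avg)
  then show ?thesis
    using assms by simp
qed

text \<open>Non-negativity makes each single term at most the whole sum, since the other terms can
  only add to it.\<close>

lemma f_max_le_mult_f_avg:
  assumes "l \<ge> 1" and "\<And>i. i \<in> {1..l} \<Longrightarrow> 0 \<le> f i X"
  shows "f_max l f X \<le> real l * f_avg l f X"
proof -
  have "f i X \<le> (\<Sum>j = 1..l. f j X)" if "i \<in> {1..l}" for i
    using that assms(2) by (intro member_le_sum) auto
  then show ?thesis
    using assms(1) by (simp add: real_mult_f_avg f_max_def)
qed

theorem theorem4: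
  fixes V :: "'a set" and l :: nat and f :: "nat \<Rightarrow> 'a set \<Rightarrow> real"
  assumes "finite V"
    and "l \<ge> 1"
    and "\<And>i X. i \<in> {1..l} \<Longrightarrow> X \<subseteq> V \<Longrightarrow> 0 \<le> f i X"
  shows "(\<forall>X. X \<subseteq> V \<longrightarrow> f_avg l f X \<le> f_max l f X \<and> f_max l f X \<le> real l * f_avg l f X)
    \<and> (\<forall>(C :: 'a set set) (\<beta> :: real) Xhat Xstar.
         C \<subseteq> Pow V \<and> C \<noteq> {} \<and> \<beta> \<ge> 1
         \<and> approx_minimizer \<beta> (f_avg l f) C Xhat
         \<and> is_arg_min (f_max l f) (\<lambda>X. X \<in> C) Xstar
         \<longrightarrow> f_max l f Xhat \<le> real l * \<beta> * f_max l f Xstar)"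
proof (intro conjI allI impI)
  fix X assume "X \<subseteq> V"
  then show "f_avg l f X \<le> f_max l f X" "f_max l f X \<le> real l * f_avg l f X"
    using assms(2,3) by (auto intro: f_avg_le_f_max f_max_le_mult_f_avg)
next
  fix C :: "'a set set" and \<beta> :: real and Xhat Xstar
  assume *: "C \<subseteq> Pow V \<and> C \<noteq> {} \<and> \<beta> \<ge> 1
         \<and> approx_minimizer \<beta> (f_avg l f) C Xhat
         \<and> is_arg_min (f_max l f) (\<lambda>X. X \<in> C) Xstar"
  then have "Xhat \<subseteq> V" and Xstar: "Xstar \<in> C" and "\<beta> \<ge> 1"
    by (auto simp: approx_minimizer_def is_arg_min_def)
  \<comment> \<open>Finiteness, inherited from \<open>Pow V\<close>, makes \<open>MIN\<close> over
    \<open>C\<close> a genuine lower bound on the averages of its members.\<close>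
  have "finite C"
    using * assms(1) finite_subset by blast
  \<comment> \<open>\<open>Xstar\<close> enters as a feasible competitor for the average.\<close>
  then have "(MIN Y\<in>C. f_avg l f Y) \<le> f_avg l f Xstar"
    using Xstar by (intro Min_le) auto
  also have "\<dots> \<le> f_max l f Xstar"
    using assms(2) by (rule f_avg_le_f_max)
  finally have min_le: "(MIN Y\<in>C. f_avg l f Y) \<le> f_max l f Xstar" .
  have "f_max l f Xhat \<le> real l * f_avg l f Xhat"
    using assms(2,3) \<open>Xhat \<subseteq> V\<close> by (intro f_max_le_mult_f_avg) auto
  also have "\<dots> \<le> real l * (\<beta> * (MIN Y\<in>C. f_avg l f Y))"
    using * by (intro mult_left_mono) (auto simp: approx_minimizer_def)
  \<comment> \<open>Monotonicity of the product uses that \<beta> is non-negative, which \<beta>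
    \<ge> 1 supplies.\<close>
  also have "\<dots> \<le> real l * (\<beta> * f_max l f Xstar)"
    using min_le \<open>\<beta> \<ge> 1\<close> by (intro mult_left_mono) auto
  finally show "f_max l f Xhat \<le> real l * \<beta> * f_max l f Xstar"
    by (simp add: mult.assoc)
qed

end
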